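(* Let $p_1,p_2\ge2$ and let $Z=(z_{jk})$ be a random $p_1\times p_2$ matrix that is matrix spherical and satisfies $\mathrm{E}\|Z\|_F^4<\infty$. Let $m_2:=\mathrm{E}(z_{11}^2z_{12}^2)$, $m_4:=\mathrm{E}(z_{11}^2z_{22}^2)$ and $$A:=\mathrm{E}\left[\{\mathrm{vec}(Z)\otimes\mathrm{vec}(Z)\}\{\mathrm{vec}(Z)\otimes\mathrm{vec}(Z)\}^{\top}\right].$$ Then $$A=\frac12(m_2-m_4)\left(J_1K_2^{\otimes}+J_2K_1^{\otimes}+J_1+J_2+K_1^{\otimes}+K_2^{\otimes}\right)+m_4\left(I_{p_1^2p_2^2}+J_1J_2+K_1^{\otimes}K_2^{\otimes}\right).$$
   Context: $Z$ is matrix spherical if $O_1ZO_2^{\top}$ has the same distribution as $Z$ for all orthogonal $O_1\in\mathbb{R}^{p_1\times p_1}$, $O_2\in\mathbb{R}^{p_2\times p_2}$. $\mathrm{vec}$ is column-wise vectorization, $\otimes$ the Kronecker product, $\|\cdot\|_F$ the Frobenius norm, and $e_k$ the $k$th standard basis vector (of $\mathbb{R}^{p_1}$ in sums up to $p_1$, of $\mathbb{R}^{p_2}$ in sums up to $p_2$). The $p_1^2p_2^2\times p_1^2p_2^2$ matrices are $$J_1=\sum_{i,j=1}^{p_1}(I_{p_2}\otimes e_ie_j^{\top}\otimes I_{p_2}\otimes e_ie_j^{\top}),\qquad J_2=\sum_{i,j=1}^{p_2}(e_ie_j^{\top}\otimes I_{p_1}\otimes e_ie_j^{\top}\otimes I_{p_1}),$$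 $$K_1^{\otimes}=\sum_{i,j=1}^{p_1}(I_{p_2}\otimes e_ie_j^{\top}\otimes I_{p_2}\otimes e_je_i^{\top}),\qquad K_2^{\otimes}=\sum_{i,j=1}^{p_2}(e_ie_j^{\top}\otimes I_{p_1}\otimes e_je_i^{\top}\otimes I_{p_1}).$$ *)

theory Defs
  imports "HOL-Probability.Probability"
begin

text \<open>
  A real \<open>p\<^sub>1 \<times> p\<^sub>2\<close> matrix is an element of \<open>real ^ 'n ^ 'm\<close> with
  \<open>p\<^sub>1 = CARD('m)\<close> rows and \<open>p\<^sub>2 = CARD('n)\<close> columns. A vector or matrix of dimension
  \<open>a b\<close> arising from a Kronecker product is indexed by pairs: the position \<open>(i - 1) b + j\<close> of
  the usual definition corresponds to the pair \<open>(i, j)\<close>, so the usual ordering of positions is the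
  lexicographic ordering of pairs. Kronecker products of more than two factors are bracketed;
  the bracketing only affects how the index tuples are nested.
\<close>

definition kron :: "real ^ 'b ^ 'a \<Rightarrow> real ^ 'd ^ 'c \<Rightarrow> real ^ ('b \<times> 'd) ^ ('a \<times> 'c)"
    (infixl "\<otimes>\<^sub>K" 70)
  where "A \<otimes>\<^sub>K B = (\<chi> p q. A $ fst p $ fst q * B $ snd p $ snd q)"

definition kron_vec :: "real ^ 'a \<Rightarrow> real ^ 'b \<Rightarrow> real ^ ('a \<times> 'b)"
    (infixl "\<otimes>\<^sub>v" 70)
  where "u \<otimes>\<^sub>v v = (\<chi> p. u $ fst p * v $ snd p)"

text \<open>The matrix \<open>u v\<^sup>T\<close>.\<close>

definition outer :: "real ^ 'a \<Rightarrow> real ^ 'b \<Rightarrow> real ^ 'b ^ 'a"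
  where "outer u v = (\<chi> i j. u $ i * v $ j)"

text \<open>
  Column-wise vectorization stacks the columns, so the column index is the leading component.
\<close>

definition vec_cols :: "real ^ 'n ^ 'm \<Rightarrow> real ^ ('n \<times> 'm)"
  where "vec_cols Z = (\<chi> p. Z $ snd p $ fst p)"

text \<open>The library norm on \<open>real ^ 'n ^ 'm\<close> is the Frobenius norm.\<close>

lemma norm_eq_frobenius:
  fixes Z :: "real ^ 'n ^ 'm"
  shows "norm Z = sqrt (\<Sum>j\<in>UNIV. \<Sum>k\<in>UNIV. (Z $ j $ k)\<^sup>2)"
  by (simp add: norm_vec_def L2_set_def sum_nonneg)

definition matrix_spherical :: "'w measure \<Rightarrow> ('w \<Rightarrow> real ^ 'n ^ 'm) \<Rightarrow> bool"
  where "matrix_spherical M Z \<longleftrightarrow>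
    (\<forall>(O1 :: real ^ 'm ^ 'm) (O2 :: real ^ 'n ^ 'n).
       orthogonal_matrix O1 \<longrightarrow> orthogonal_matrix O2 \<longrightarrow>
       distr M borel (\<lambda>\<omega>. O1 ** Z \<omega> ** transpose O2) = distr M borel Z)"

abbreviation unit_mat :: "'a \<Rightarrow> 'a \<Rightarrow> real ^ 'a ^ 'a"
  where "unit_mat i j \<equiv> outer (axis i 1) (axis j 1)"

definition J1 :: "real ^ ((('n::finite) \<times> ('m::finite)) \<times> ('n \<times> 'm)) ^ (('n \<times> 'm) \<times> ('n \<times> 'm))"
  where "J1 = (\<Sum>i\<in>(UNIV :: 'm set). \<Sum>j\<in>(UNIV :: 'm set).
    ((mat 1 :: real ^ 'n ^ 'n) \<otimes>\<^sub>K unit_mat i j) \<otimes>\<^sub>K ((mat 1 :: real ^ 'n ^ 'n) \<otimes>\<^sub>K unit_mat i j))"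

definition J2 :: "real ^ ((('n::finite) \<times> ('m::finite)) \<times> ('n \<times> 'm)) ^ (('n \<times> 'm) \<times> ('n \<times> 'm))"
  where "J2 = (\<Sum>i\<in>(UNIV :: 'n set). \<Sum>j\<in>(UNIV :: 'n set).
    (unit_mat i j \<otimes>\<^sub>K (mat 1 :: real ^ 'm ^ 'm)) \<otimes>\<^sub>K (unit_mat i j \<otimes>\<^sub>K (mat 1 :: real ^ 'm ^ 'm)))"

definition K1 :: "real ^ ((('n::finite) \<times> ('m::finite)) \<times> ('n \<times> 'm)) ^ (('n \<times> 'm) \<times> ('n \<times> 'm))"
  where "K1 = (\<Sum>i\<in>(UNIV :: 'm set). \<Sum>j\<in>(UNIV :: 'm set).
    ((mat 1 :: real ^ 'n ^ 'n) \<otimes>\<^sub>K unit_mat i j) \<otimes>\<^sub>K ((mat 1 :: real ^ 'n ^ 'n) \<otimes>\<^sub>K unit_mat j i))"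

definition K2 :: "real ^ ((('n::finite) \<times> ('m::finite)) \<times> ('n \<times> 'm)) ^ (('n \<times> 'm) \<times> ('n \<times> 'm))"
  where "K2 = (\<Sum>i\<in>(UNIV :: 'n set). \<Sum>j\<in>(UNIV :: 'n set).
    (unit_mat i j \<otimes>\<^sub>K (mat 1 :: real ^ 'm ^ 'm)) \<otimes>\<^sub>K (unit_mat j i \<otimes>\<^sub>K (mat 1 :: real ^ 'm ^ 'm)))"

end

theory Submission
  imports Defs
begin

text \<open>
  For fixed column indices, the fourth moments of the entries of \<open>Z\<close> form a tensor in the four row
  indices that is invariant under the orthogonal group, and likewise with rows and columns
  exchanged. An invariant tensor of order four is a combination of the three pairings of the
  indices: sign changes kill every unpaired entry, permutations identify the entries of each
  pairing pattern, and a rotation by 45 degrees gives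
  \<open>t\<^sub>1\<^sub>1\<^sub>1\<^sub>1 = t\<^sub>1\<^sub>1\<^sub>2\<^sub>2 + t\<^sub>1\<^sub>2\<^sub>1\<^sub>2 + t\<^sub>1\<^sub>2\<^sub>2\<^sub>1\<close>. Applied to rows and to columns this leaves nine terms, one for each
  choice of a row pairing and a column pairing, and these are the nine matrices of the theorem.
  Reordering the factors shows that the coefficient is \<open>m\<^sub>4\<close> if the two pairings agree and
  a common value \<open>m\<^sub>3\<close> otherwise; expanding \<open>m\<^sub>2\<close> in its row indices yields
  \<open>m\<^sub>2 = m\<^sub>4 + 2 m\<^sub>3\<close>.
\<close>

section \<open>Entries of the nine matrices\<close>

lemma sum_UNIV_single:
  fixes f :: "'a::finite \<Rightarrow> 'b::comm_monoid_add"
  assumes "\<And>x. x \<noteq> a \<Longrightarrow> f x = 0"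
  shows "sum f UNIV = f a"
proof -
  have "sum f UNIV = sum f {a}"
    by (rule sum.mono_neutral_right) (use assms in auto)
  then show ?thesis by simp
qed

text \<open>Each Kronecker product of unit matrices is an indicator of index equalities, and the
  double sum keeps only one term. With the row indices of \<open>Z\<close> listed as
  \<open>a, b, a', b'\<close> and the column indices as \<open>c, d, c', d'\<close>,
  \<open>J1\<close> pairs rows as 12|34 and columns as 13|24. The three matrices below are read in
  the same way.\<close>

lemma J1_nth:
  "J1 $ ((c, a), (d, b)) $ ((c', a'), (d', b')) = of_bool (a = b \<and> a' = b' \<and> c = c' \<and> d = d')"
proof -
  have "J1 $ ((c, a), (d, b)) $ ((c', a'), (d', b'))
    = (\<Sum>i\<in>UNIV. \<Sum>j\<in>UNIV. of_bool (i = a \<and> i = b \<and> j = a' \<and> j = b' \<and> c = c' \<and> d = d'))"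
    unfolding J1_def sum_component
    by (intro sum.cong) (auto simp: kron_def outer_def mat_def axis_def)
  also have "\<dots> = (\<Sum>j\<in>UNIV. of_bool (a = b \<and> j = a' \<and> j = b' \<and> c = c' \<and> d = d'))"
    by (subst sum_UNIV_single[where a = a]) auto
  also have "\<dots> = of_bool (a = b \<and> a' = b' \<and> c = c' \<and> d = d')"
    by (subst sum_UNIV_single[where a = a']) auto
  finally show ?thesis .
qed

lemma K1_nth:
  "K1 $ ((c, a), (d, b)) $ ((c', a'), (d', b')) = of_bool (a = b' \<and> b = a' \<and> c = c' \<and> d = d')"
proof -
  have "K1 $ ((c, a), (d, b)) $ ((c', a'), (d', b'))
    = (\<Sum>i\<in>UNIV. \<Sum>j\<in>UNIV. of_bool (i = a \<and> i = b' \<and> j = a' \<and> j = b \<and> c = c' \<and> d = d'))"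
    unfolding K1_def sum_component
    by (intro sum.cong) (auto simp: kron_def outer_def mat_def axis_def)
  also have "\<dots> = (\<Sum>j\<in>UNIV. of_bool (a = b' \<and> j = a' \<and> j = b \<and> c = c' \<and> d = d'))"
    by (subst sum_UNIV_single[where a = a]) auto
  also have "\<dots> = of_bool (a = b' \<and> b = a' \<and> c = c' \<and> d = d')"
    by (subst sum_UNIV_single[where a = a']) auto
  finally show ?thesis .
qed

lemma J2_nth:
  "J2 $ ((c, a), (d, b)) $ ((c', a'), (d', b')) = of_bool (a = a' \<and> b = b' \<and> c = d \<and> c' = d')"
proof -
  have "J2 $ ((c, a), (d, b)) $ ((c', a'), (d', b'))
    = (\<Sum>i\<in>UNIV. \<Sum>j\<in>UNIV. of_bool (i = c \<and> i = d \<and> j = c' \<and> j = d' \<and> a = a' \<and> b = b'))"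
    unfolding J2_def sum_component
    by (intro sum.cong) (auto simp: kron_def outer_def mat_def axis_def)
  also have "\<dots> = (\<Sum>j\<in>UNIV. of_bool (c = d \<and> j = c' \<and> j = d' \<and> a = a' \<and> b = b'))"
    by (subst sum_UNIV_single[where a = c]) auto
  also have "\<dots> = of_bool (a = a' \<and> b = b' \<and> c = d \<and> c' = d')"
    by (subst sum_UNIV_single[where a = c']) auto
  finally show ?thesis .
qed

lemma K2_nth:
  "K2 $ ((c, a), (d, b)) $ ((c', a'), (d', b')) = of_bool (a = a' \<and> b = b' \<and> c = d' \<and> d = c')"
proof -
  have "K2 $ ((c, a), (d, b)) $ ((c', a'), (d', b'))
    = (\<Sum>i\<in>UNIV. \<Sum>j\<in>UNIV. of_bool (i = c \<and> i = d' \<and> j = c' \<and> j = d \<and> a = a' \<and> b = b'))"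
    unfolding K2_def sum_component
    by (intro sum.cong) (auto simp: kron_def outer_def mat_def axis_def)
  also have "\<dots> = (\<Sum>j\<in>UNIV. of_bool (c = d' \<and> j = c' \<and> j = d \<and> a = a' \<and> b = b'))"
    by (subst sum_UNIV_single[where a = c]) auto
  also have "\<dots> = of_bool (a = a' \<and> b = b' \<and> c = d' \<and> d = c')"
    by (subst sum_UNIV_single[where a = c']) auto
  finally show ?thesis .
qed

text \<open>\<open>J1\<close> and \<open>K1\<close> leave column indices alone, \<open>J2\<close>
  and \<open>K2\<close> leave row indices alone. Hence in a product of one matrix from each group
  the intermediate index is forced, and the product combines the row pairing of one factor with the
  column pairing of the other.\<close>

lemma J1_mult_K2_nth:
  "(J1 ** K2) $ ((c, a), (d, b)) $ ((c', a'), (d', b')) =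
     of_bool (a = b \<and> a' = b' \<and> c = d' \<and> d = c')"
  unfolding matrix_matrix_mult_def vec_lambda_beta
  by (subst sum_UNIV_single[where a = "((c, a'), (d, b'))"]) (auto simp: J1_nth K2_nth)

lemma J2_mult_K1_nth:
  "(J2 ** K1) $ ((c, a), (d, b)) $ ((c', a'), (d', b')) =
     of_bool (a = b' \<and> b = a' \<and> c = d \<and> c' = d')"
  unfolding matrix_matrix_mult_def vec_lambda_beta
  by (subst sum_UNIV_single[where a = "((c', a), (d', b))"]) (auto simp: J2_nth K1_nth)

lemma J1_mult_J2_nth:
  "(J1 ** J2) $ ((c, a), (d, b)) $ ((c', a'), (d', b')) =
     of_bool (a = b \<and> a' = b' \<and> c = d \<and> c' = d')"
  unfolding matrix_matrix_mult_def vec_lambda_beta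
  by (subst sum_UNIV_single[where a = "((c, a'), (d, b'))"]) (auto simp: J1_nth J2_nth)

lemma K1_mult_K2_nth:
  "(K1 ** K2) $ ((c, a), (d, b)) $ ((c', a'), (d', b')) =
     of_bool (a = b' \<and> b = a' \<and> c = d' \<and> d = c')"
  unfolding matrix_matrix_mult_def vec_lambda_beta
  by (subst sum_UNIV_single[where a = "((c, a'), (d, b'))"]) (auto simp: K1_nth K2_nth)

lemma mat_1_pair_nth:
  "(mat 1 :: real ^ (('n::finite \<times> 'm::finite) \<times> ('n \<times> 'm)) ^ (('n \<times> 'm) \<times> ('n \<times> 'm)))
     $ ((c, a), (d, b)) $ ((c', a'), (d', b')) =
     of_bool (a = a' \<and> b = b' \<and> c = c' \<and> d = d')"
  by (auto simp: mat_def)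

section \<open>Tensors of order four invariant under the orthogonal group\<close>

definition orthogonal_invariant4 :: "('a::finite \<Rightarrow> 'a \<Rightarrow> 'a \<Rightarrow> 'a \<Rightarrow> real) \<Rightarrow> bool"
  where "orthogonal_invariant4 t \<longleftrightarrow> (\<forall>(Q :: real ^ 'a ^ 'a) a b c d. orthogonal_matrix Q \<longrightarrow>
    t a b c d = (\<Sum>i\<in>UNIV. \<Sum>j\<in>UNIV. \<Sum>k\<in>UNIV. \<Sum>l\<in>UNIV.
      Q $ a $ i * Q $ b $ j * Q $ c $ k * Q $ d $ l * t i j k l))"

text \<open>The rows are distinct standard basis vectors up to sign, hence orthonormal; a one-sided
  inverse suffices because the matrix is square.\<close>

lemma orthogonal_matrix_signed_permutation:
  fixes \<pi> :: "'a::finite \<Rightarrow> 'a" and s :: "'a \<Rightarrow> real"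
  assumes "inj \<pi>" and "\<And>a. s a * s a = 1"
  shows "orthogonal_matrix (\<chi> a i. if i = \<pi> a then s a else 0)"
proof -
  have "(\<Sum>k\<in>UNIV. (if k = \<pi> i then s i else 0) * (if k = \<pi> j then s j else 0)) =
      (if i = j then 1 else 0)" for i j
    by (subst sum_UNIV_single[where a = "\<pi> i"]) (use assms in \<open>auto simp: inj_eq\<close>)
  then have "(\<chi> a i. if i = \<pi> a then s a else 0) ** transpose (\<chi> a i. if i = \<pi> a then s a else 0) = mat 1"
    by (simp add: vec_eq_iff matrix_matrix_mult_def transpose_def mat_def)
  then show ?thesis
    unfolding orthogonal_matrix_def by (simp add: matrix_left_right_inverse)
qed

text \<open>Row \<open>a\<close> of the matrix has its only nonzero entry in column
  \<open>\<pi> a\<close>, so the fourfold sum collapses to one term. Sign changes and permutations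
  are both special cases.\<close>

lemma orthogonal_invariant4_signed_permutation:
  fixes \<pi> :: "'a::finite \<Rightarrow> 'a" and s :: "'a \<Rightarrow> real"
  assumes "orthogonal_invariant4 t" and "inj \<pi>" and "\<And>a. s a * s a = 1"
  shows "t a b c d = s a * s b * s c * s d * t (\<pi> a) (\<pi> b) (\<pi> c) (\<pi> d)"
proof -
  define Q :: "real ^ 'a ^ 'a" where "Q = (\<chi> a i. if i = \<pi> a then s a else 0)"
  have "orthogonal_matrix Q"
    unfolding Q_def using assms(2,3) by (rule orthogonal_matrix_signed_permutation)
  then have "t a b c d = (\<Sum>i\<in>UNIV. \<Sum>j\<in>UNIV. \<Sum>k\<in>UNIV. \<Sum>l\<in>UNIV.
      Q $ a $ i * Q $ b $ j * Q $ c $ k * Q $ d $ l * t i j k l)"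
    using assms(1) unfolding orthogonal_invariant4_def by blast
  also have "\<dots> = Q $ a $ \<pi> a * Q $ b $ \<pi> b * Q $ c $ \<pi> c * Q $ d $ \<pi> d * t (\<pi> a) (\<pi> b) (\<pi> c) (\<pi> d)"
    by (subst sum_UNIV_single[where a = "\<pi> a"], simp add: Q_def,
        subst sum_UNIV_single[where a = "\<pi> b"], simp add: Q_def,
        subst sum_UNIV_single[where a = "\<pi> c"], simp add: Q_def,
        subst sum_UNIV_single[where a = "\<pi> d"], simp add: Q_def, rule refl)
  finally show ?thesis by (simp add: Q_def)
qed

lemma orthogonal_invariant4_permutation:
  assumes "orthogonal_invariant4 t" and "inj \<pi>"
  shows "t a b c d = t (\<pi> a) (\<pi> b) (\<pi> c) (\<pi> d)"
  using orthogonal_invariant4_signed_permutation[OF assms, of "\<lambda>_. 1"] by simp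

text \<open>Flipping the sign of a coordinate \<open>x\<close> that occurs an odd number of times
  shows that the entry equals its own negative.\<close>

lemma orthogonal_invariant4_eq_0:
  assumes t: "orthogonal_invariant4 t"
    and odd: "\<exists>x. odd (of_bool (a = x) + of_bool (b = x) + of_bool (c = x) + of_bool (d = x) :: nat)"
  shows "t a b c d = 0"
proof -
  obtain x where x: "odd (of_bool (a = x) + of_bool (b = x) + of_bool (c = x) + of_bool (d = x) :: nat)"
    using odd by blast
  define s :: "'a \<Rightarrow> real" where "s i = (if i = x then -1 else 1)" for i
  have "t a b c d = s a * s b * s c * s d * t a b c d"
    using orthogonal_invariant4_signed_permutation[OF t, of "\<lambda>i. i" s] by (simp add: s_def)
  moreover have "s a * s b * s c * s d = -1"
    using x by (auto simp: s_def of_bool_def split: if_splits)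
  ultimately show ?thesis by simp
qed

text \<open>One transposition sends \<open>a\<close> to \<open>r1\<close>; a second one sends the
  image of \<open>b\<close> to \<open>r2\<close> without moving \<open>r1\<close>. This carries any
  two distinct indices to the reference pair.\<close>

lemma inj_two_points:
  assumes "a \<noteq> b" and "r1 \<noteq> r2"
  obtains \<pi> :: "'a \<Rightarrow> 'a" where "inj \<pi>" "\<pi> a = r1" "\<pi> b = r2"
proof -
  define b' where "b' = Transposition.transpose a r1 b"
  have "b' \<noteq> r1"
    using assms(1) unfolding b'_def by (metis transpose_apply_first transpose_involutory)
  show thesis
  proof
    show "inj (Transposition.transpose b' r2 \<circ> Transposition.transpose a r1)"
      by (intro inj_compose inj_transpose)
  qed (use \<open>b' \<noteq> r1\<close> assms in \<open>auto simp: b'_def\<close>)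
qed

lemma orthogonal_invariant4_diagonal:
  fixes t :: "'a::finite \<Rightarrow> 'a \<Rightarrow> 'a \<Rightarrow> 'a \<Rightarrow> real"
  assumes t: "orthogonal_invariant4 t" and r: "r1 \<noteq> r2"
  shows "t r1 r1 r1 r1 = t r1 r1 r2 r2 + t r1 r2 r1 r2 + t r1 r2 r2 r1"
proof -
  define h :: real where "h = 1 / sqrt 2"
  have h: "h * h = 1 / 2" by (simp add: h_def)
  \<comment> \<open>The first row of a rotation by 45 degrees in the plane of \<open>r1\<close> and
    \<open>r2\<close>.\<close>
  define v :: "real ^ 'a" where "v = (\<chi> i. if i = r1 \<or> i = r2 then h else 0)"
  have sum_v: "(\<Sum>i\<in>UNIV. v $ i * f i) = h * f r1 + h * f r2" for f :: "'a \<Rightarrow> real"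
  proof -
    have "(\<Sum>i\<in>UNIV. v $ i * f i) = (\<Sum>i\<in>{r1, r2}. v $ i * f i)"
      by (rule sum.mono_neutral_right) (auto simp: v_def)
    then show ?thesis using r by (simp add: v_def)
  qed
  have "v \<bullet> v = 1"
    by (simp add: inner_vec_def sum_v) (simp add: v_def h)
  then have "norm v = 1" by (simp add: norm_eq_sqrt_inner)
  then obtain P :: "real ^ 'a ^ 'a" where P: "orthogonal_matrix P" "P *v axis r1 1 = v"
    using orthogonal_matrix_exists_basis by metis
  \<comment> \<open>\<open>v\<close> is column \<open>r1\<close> of \<open>P\<close>; invariance is
    phrased through rows, so the transpose is taken.\<close>
  define Q where "Q = transpose P"
  have Q: "orthogonal_matrix Q" using P(1) by (simp add: Q_def)
  have Qr: "Q $ r1 $ i = v $ i" for i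
    using P(2) by (simp add: Q_def transpose_def matrix_vector_mult_basis column_def flip: P(2))
  have swap: "t r2 r2 r2 r2 = t r1 r1 r1 r1" "t r2 r2 r1 r1 = t r1 r1 r2 r2"
    "t r2 r1 r2 r1 = t r1 r2 r1 r2" "t r2 r1 r1 r2 = t r1 r2 r2 r1"
    by (simp_all add: orthogonal_invariant4_permutation[OF t inj_transpose[of r1 r2], of r2])
  \<comment> \<open>In each of these entries \<open>r1\<close> occurs once or three times.\<close>
  have zero: "t r1 r1 r1 r2 = 0" "t r1 r1 r2 r1 = 0" "t r1 r2 r1 r1 = 0" "t r2 r1 r1 r1 = 0"
    "t r2 r2 r2 r1 = 0" "t r2 r2 r1 r2 = 0" "t r2 r1 r2 r2 = 0" "t r1 r2 r2 r2 = 0"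
    by (rule orthogonal_invariant4_eq_0[OF t], rule exI[of _ r1], simp add: r r[symmetric])+
  have "t r1 r1 r1 r1 = (\<Sum>i\<in>UNIV. \<Sum>j\<in>UNIV. \<Sum>k\<in>UNIV. \<Sum>l\<in>UNIV.
      v $ i * v $ j * v $ k * v $ l * t i j k l)"
    using t[unfolded orthogonal_invariant4_def, rule_format, OF Q, of r1 r1 r1 r1] by (simp only: Qr)
  \<comment> \<open>Of the 16 terms, each weighted by 1/4, the eight odd ones vanish, two are
    diagonal entries, and the six paired ones agree two by two after exchanging \<open>r1\<close>
    and \<open>r2\<close>.\<close>
  also have "\<dots> = (h * h) * (h * h) * (2 * t r1 r1 r1 r1 + 2 * (t r1 r1 r2 r2 + t r1 r2 r1 r2 + t r1 r2 r2 r1))"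
    by (simp only: mult.assoc sum_v flip: sum_distrib_left) (simp add: zero swap algebra_simps)
  also have "\<dots> = t r1 r1 r1 r1 / 2 + (t r1 r1 r2 r2 + t r1 r2 r1 r2 + t r1 r2 r2 r1) / 2"
    by (simp add: h field_simps)
  finally have "t r1 r1 r1 r1 = t r1 r1 r1 r1 / 2 + (t r1 r1 r2 r2 + t r1 r2 r1 r2 + t r1 r2 r2 r1) / 2" .
  moreover have "x = s" if "x = x / 2 + s / 2" for x s :: real
    using that by simp
  ultimately show ?thesis by blast
qed

text \<open>If exactly one pairing holds, a permutation moves the entry to the reference pair; if
  all four indices agree, all three pairings hold and the diagonal identity applies; otherwise the
  entry vanishes.\<close>

lemma orthogonal_invariant4_expansion:
  fixes t :: "'a::finite \<Rightarrow> 'a \<Rightarrow> 'a \<Rightarrow> 'a \<Rightarrow> real"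
  assumes t: "orthogonal_invariant4 t" and r: "r1 \<noteq> r2"
  shows "t a b c d = of_bool (a = b \<and> c = d) * t r1 r1 r2 r2
    + of_bool (a = c \<and> b = d) * t r1 r2 r1 r2 + of_bool (a = d \<and> b = c) * t r1 r2 r2 r1"
proof -
  have perm: "t x x y y = t r1 r1 r2 r2 \<and> t x y x y = t r1 r2 r1 r2 \<and> t x y y x = t r1 r2 r2 r1"
    if xy: "x \<noteq> y" for x y
  proof -
    obtain \<pi> :: "'a \<Rightarrow> 'a" where \<pi>: "inj \<pi>" "\<pi> x = r1" "\<pi> y = r2"
      using inj_two_points[OF xy r] by blast
    show ?thesis
      using orthogonal_invariant4_permutation[OF t \<pi>(1), of x] \<pi>(2,3) by simp
  qed
  have diag: "t x x x x = t r1 r1 r2 r2 + t r1 r2 r1 r2 + t r1 r2 r2 r1" for x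
  proof -
    obtain y where "x \<noteq> y" using r by (cases "x = r1") auto
    then show ?thesis
      using orthogonal_invariant4_diagonal[OF t \<open>x \<noteq> y\<close>] perm by simp
  qed
  consider (pair) "a = b \<and> c = d \<or> a = c \<and> b = d \<or> a = d \<and> b = c"
    | (unpaired) "\<not> (a = b \<and> c = d \<or> a = c \<and> b = d \<or> a = d \<and> b = c)" by blast
  then show ?thesis
  proof cases
    case pair
    then show ?thesis
      by (elim disjE conjE; cases "a = b"; cases "b = c"; simp add: diag perm)
  next
    case unpaired
    \<comment> \<open>If every value occurred an even number of times, the four indices would split
      into two equal pairs.\<close>
    then have "\<exists>x\<in>{a, b, c, d}. odd (of_bool (a = x) + of_bool (b = x) + of_bool (c = x) + of_bool (d = x) :: nat)"
      by auto
    then have "t a b c d = 0"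
      using orthogonal_invariant4_eq_0[OF t] by blast
    moreover have "(a = b \<and> c = d) = False" "(a = c \<and> b = d) = False" "(a = d \<and> b = c) = False"
      using unpaired by blast+
    ultimately show ?thesis by (simp only: of_bool_eq)
  qed
qed

section \<open>Fourth moments of a matrix spherical random matrix\<close>

lemma sum_product4:
  fixes f g h e :: "'a \<Rightarrow> 'b::comm_semiring_0"
  shows "(\<Sum>i\<in>I. f i) * (\<Sum>j\<in>I. g j) * (\<Sum>k\<in>I. h k) * (\<Sum>l\<in>I. e l) =
    (\<Sum>i\<in>I. \<Sum>j\<in>I. \<Sum>k\<in>I. \<Sum>l\<in>I. f i * g j * h k * e l)"
  by (simp only: flip: sum_distrib_left sum_distrib_right)

text \<open>Multilinearity of the moment. The four families are independent of each other so that
  they can be four columns of \<open>Z\<close> for the row action and four rows for the column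
  action.\<close>

lemma integral_linear_combinations4:
  fixes q1 q2 q3 q4 :: "'a::finite \<Rightarrow> real" and X1 X2 X3 X4 :: "'w \<Rightarrow> 'a \<Rightarrow> real"
  assumes "\<And>i j k l. integrable M (\<lambda>\<omega>. X1 \<omega> i * X2 \<omega> j * X3 \<omega> k * X4 \<omega> l)"
  shows "(\<integral>\<omega>. (\<Sum>i\<in>UNIV. q1 i * X1 \<omega> i) * (\<Sum>i\<in>UNIV. q2 i * X2 \<omega> i)
      * (\<Sum>i\<in>UNIV. q3 i * X3 \<omega> i) * (\<Sum>i\<in>UNIV. q4 i * X4 \<omega> i) \<partial>M) =
    (\<Sum>i\<in>UNIV. \<Sum>j\<in>UNIV. \<Sum>k\<in>UNIV. \<Sum>l\<in>UNIV.
      q1 i * q2 j * q3 k * q4 l * (\<integral>\<omega>. X1 \<omega> i * X2 \<omega> j * X3 \<omega> k * X4 \<omega> l \<partial>M))"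
proof -
  have eq: "(q1 i * X1 \<omega> i) * (q2 j * X2 \<omega> j) * (q3 k * X3 \<omega> k) * (q4 l * X4 \<omega> l) =
      (q1 i * q2 j * q3 k * q4 l) * (X1 \<omega> i * X2 \<omega> j * X3 \<omega> k * X4 \<omega> l)" for i j k l \<omega>
    by (simp add: algebra_simps)
  show ?thesis
    unfolding sum_product4 eq
    using assms by (simp add: Bochner_Integration.integral_sum)
qed

text \<open>The components may themselves be vectors, so two applications lead from the entries of a
  matrix to the matrix.\<close>

lemma integrable_vec:
  fixes f :: "'w \<Rightarrow> 'b::euclidean_space ^ 'a::finite"
  assumes "\<And>i. integrable M (\<lambda>\<omega>. f \<omega> $ i)"
  shows "integrable M f"
proof -
  have "integrable M (\<lambda>\<omega>. \<Sum>b\<in>Basis. (f \<omega> \<bullet> b) *\<^sub>R b)"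
    using assms by (intro Bochner_Integration.integrable_sum integrable_scaleR_left)
      (auto simp: Basis_vec_def inner_axis)
  then show ?thesis by (simp add: euclidean_representation)
qed

lemma integral_vec_nth:
  fixes f :: "'w \<Rightarrow> 'b::euclidean_space ^ 'a::finite"
  assumes "integrable M f"
  shows "(\<integral>\<omega>. f \<omega> \<partial>M) $ i = (\<integral>\<omega>. f \<omega> $ i \<partial>M)"
  using integral_bounded_linear[OF bounded_linear_vec_nth assms] by simp

lemma borel_measurable_matrix_nth:
  "(\<lambda>X :: real ^ 'n::finite ^ 'm::finite. X $ i $ j) \<in> borel_measurable borel"
  by (intro borel_measurable_continuous_onI continuous_intros)

lemma borel_measurable_matrix_mult:
  fixes P :: "real ^ 'm ^ 'm::finite" and Q :: "real ^ 'n ^ 'n::finite"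
  shows "(\<lambda>X. P ** X ** Q) \<in> borel_measurable borel"
  unfolding matrix_matrix_mult_def
  by (intro borel_measurable_continuous_onI continuous_intros)

text \<open>Every entry is bounded by the Frobenius norm, so a product of four is dominated by its
  fourth power.\<close>

lemma integrable_entries4:
  fixes Z :: "'w \<Rightarrow> real ^ 'n::finite ^ 'm::finite"
  assumes Z: "Z \<in> borel_measurable M" and int: "integrable M (\<lambda>\<omega>. norm (Z \<omega>) ^ 4)"
  shows "integrable M (\<lambda>\<omega>. Z \<omega> $ a $ i * Z \<omega> $ b $ j * Z \<omega> $ c $ k * Z \<omega> $ d $ l)"
proof (rule Bochner_Integration.integrable_bound[OF int])
  have [measurable]: "(\<lambda>\<omega>. Z \<omega> $ a $ i) \<in> borel_measurable M" for a i
    using measurable_compose[OF Z borel_measurable_matrix_nth] .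
  show "(\<lambda>\<omega>. Z \<omega> $ a $ i * Z \<omega> $ b $ j * Z \<omega> $ c $ k * Z \<omega> $ d $ l) \<in> borel_measurable M"
    by measurable
  have entry: "\<bar>Z \<omega> $ a $ i\<bar> \<le> norm (Z \<omega>)" for \<omega> a i
    by (rule order_trans[OF component_le_norm_cart Finite_Cartesian_Product.norm_nth_le])
  have "\<bar>Z \<omega> $ a $ i * Z \<omega> $ b $ j * Z \<omega> $ c $ k * Z \<omega> $ d $ l\<bar>
      \<le> norm (Z \<omega>) * norm (Z \<omega>) * norm (Z \<omega>) * norm (Z \<omega>)" for \<omega>
    unfolding abs_mult by (intro mult_mono entry) auto
  then show "AE \<omega> in M. norm (Z \<omega> $ a $ i * Z \<omega> $ b $ j * Z \<omega> $ c $ k * Z \<omega> $ d $ l)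
      \<le> norm (norm (Z \<omega>) ^ 4)"
    by (simp add: power4_eq_xxxx)
qed

lemma matrix_spherical_integral:
  fixes Z :: "'w \<Rightarrow> real ^ 'n::finite ^ 'm::finite" and f :: "real ^ 'n ^ 'm \<Rightarrow> real"
  assumes Z: "Z \<in> borel_measurable M" and sph: "matrix_spherical M Z"
    and f: "f \<in> borel_measurable borel" and O1: "orthogonal_matrix O1" and O2: "orthogonal_matrix O2"
  shows "(\<integral>\<omega>. f (Z \<omega>) \<partial>M) = (\<integral>\<omega>. f (O1 ** Z \<omega> ** transpose O2) \<partial>M)"
proof -
  have "(\<integral>\<omega>. f (Z \<omega>) \<partial>M) = (\<integral>X. f X \<partial>distr M borel Z)"
    using integral_distr[OF Z f] by simp
  also have "distr M borel Z = distr M borel (\<lambda>\<omega>. O1 ** Z \<omega> ** transpose O2)"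
    using sph O1 O2 unfolding matrix_spherical_def by auto
  also have "(\<integral>X. f X \<partial>\<dots>) = (\<integral>\<omega>. f (O1 ** Z \<omega> ** transpose O2) \<partial>M)"
    by (rule integral_distr[OF measurable_compose[OF Z borel_measurable_matrix_mult] f])
  finally show ?thesis .
qed

text \<open>The row indices come first, so that fixing them leaves a tensor in the column indices by
  partial application.\<close>

definition moment4 :: "'w measure \<Rightarrow> ('w \<Rightarrow> real ^ 'n ^ 'm) \<Rightarrow>
    'm \<Rightarrow> 'm \<Rightarrow> 'm \<Rightarrow> 'm \<Rightarrow> 'n \<Rightarrow> 'n \<Rightarrow> 'n \<Rightarrow> 'n \<Rightarrow> real"
  where "moment4 M Z a b c d i j k l =
    (\<integral>\<omega>. Z \<omega> $ a $ i * Z \<omega> $ b $ j * Z \<omega> $ c $ k * Z \<omega> $ d $ l \<partial>M)"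

text \<open>Taking one of the two orthogonal matrices to be the identity lets the other act on the
  row indices alone or on the column indices alone; multilinearity then turns equality in
  distribution into tensor invariance.\<close>

lemma
  fixes Z :: "'w \<Rightarrow> real ^ 'n::finite ^ 'm::finite"
  assumes Z: "Z \<in> borel_measurable M" and sph: "matrix_spherical M Z"
    and int: "integrable M (\<lambda>\<omega>. norm (Z \<omega>) ^ 4)"
  shows moment4_row_invariant: "orthogonal_invariant4 (\<lambda>a b c d. moment4 M Z a b c d i j k l)"
    and moment4_column_invariant: "orthogonal_invariant4 (moment4 M Z a b c d)"
proof -
  have meas: "(\<lambda>X :: real ^ 'n ^ 'm. X $ a $ i * X $ b $ j * X $ c $ k * X $ d $ l)
      \<in> borel_measurable borel" for a b c d i j k l
    by (intro borel_measurable_times borel_measurable_matrix_nth)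
  show "orthogonal_invariant4 (\<lambda>a b c d. moment4 M Z a b c d i j k l)"
    unfolding orthogonal_invariant4_def
  proof (intro allI impI)
    fix Q :: "real ^ 'm ^ 'm" and a b c d
    assume Q: "orthogonal_matrix Q"
    have "moment4 M Z a b c d i j k l = (\<integral>\<omega>. (Q ** Z \<omega>) $ a $ i * (Q ** Z \<omega>) $ b $ j
        * (Q ** Z \<omega>) $ c $ k * (Q ** Z \<omega>) $ d $ l \<partial>M)"
      unfolding moment4_def
      using matrix_spherical_integral[OF Z sph meas Q orthogonal_matrix_id] by simp
    also have "\<dots> = (\<Sum>i'\<in>UNIV. \<Sum>j'\<in>UNIV. \<Sum>k'\<in>UNIV. \<Sum>l'\<in>UNIV.
        Q $ a $ i' * Q $ b $ j' * Q $ c $ k' * Q $ d $ l' * moment4 M Z i' j' k' l' i j k l)"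
      unfolding moment4_def matrix_matrix_mult_def vec_lambda_beta
      by (rule integral_linear_combinations4) (rule integrable_entries4[OF Z int])
    finally show "moment4 M Z a b c d i j k l = \<dots>" .
  qed
  show "orthogonal_invariant4 (moment4 M Z a b c d)"
    unfolding orthogonal_invariant4_def
  proof (intro allI impI)
    fix Q :: "real ^ 'n ^ 'n" and i j k l
    assume Q: "orthogonal_matrix Q"
    have "moment4 M Z a b c d i j k l = (\<integral>\<omega>. (Z \<omega> ** transpose Q) $ a $ i * (Z \<omega> ** transpose Q) $ b $ j
        * (Z \<omega> ** transpose Q) $ c $ k * (Z \<omega> ** transpose Q) $ d $ l \<partial>M)"
      unfolding moment4_def
      using matrix_spherical_integral[OF Z sph meas orthogonal_matrix_id Q] by simp
    also have "\<dots> = (\<integral>\<omega>. (\<Sum>x\<in>UNIV. Q $ i $ x * Z \<omega> $ a $ x) * (\<Sum>x\<in>UNIV. Q $ j $ x * Z \<omega> $ b $ x)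
        * (\<Sum>x\<in>UNIV. Q $ k $ x * Z \<omega> $ c $ x) * (\<Sum>x\<in>UNIV. Q $ l $ x * Z \<omega> $ d $ x) \<partial>M)"
      by (simp add: matrix_matrix_mult_def transpose_def mult.commute[of "Q $ _ $ _"])
    also have "\<dots> = (\<Sum>i'\<in>UNIV. \<Sum>j'\<in>UNIV. \<Sum>k'\<in>UNIV. \<Sum>l'\<in>UNIV.
        Q $ i $ i' * Q $ j $ j' * Q $ k $ k' * Q $ l $ l' * moment4 M Z a b c d i' j' k' l')"
      unfolding moment4_def
      by (rule integral_linear_combinations4) (rule integrable_entries4[OF Z int])
    finally show "moment4 M Z a b c d i j k l = \<dots>" .
  qed
qed

section \<open>The nine coefficients of the expansion\<close>

theorem theorem9:
  fixes M :: "'w measure"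
    and Z :: "'w \<Rightarrow> real ^ ('n::finite) ^ ('m::finite)"
    and r1 r2 :: 'm and c1 c2 :: 'n
    and m2 m4 :: real
    and A :: "real ^ (('n \<times> 'm) \<times> ('n \<times> 'm)) ^ (('n \<times> 'm) \<times> ('n \<times> 'm))"
  assumes "prob_space M"
    and "CARD('m) \<ge> 2" and "CARD('n) \<ge> 2"
    and "Z \<in> borel_measurable M"
    and "matrix_spherical M Z"
    and "integrable M (\<lambda>\<omega>. norm (Z \<omega>) ^ 4)"
    and "r1 \<noteq> r2" and "c1 \<noteq> c2"
    and "m2 = prob_space.expectation M (\<lambda>\<omega>. (Z \<omega> $ r1 $ c1)\<^sup>2 * (Z \<omega> $ r1 $ c2)\<^sup>2)"
    and "m4 = prob_space.expectation M (\<lambda>\<omega>. (Z \<omega> $ r1 $ c1)\<^sup>2 * (Z \<omega> $ r2 $ c2)\<^sup>2)"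
    and "A = prob_space.expectation M (\<lambda>\<omega>.
           outer (vec_cols (Z \<omega>) \<otimes>\<^sub>v vec_cols (Z \<omega>)) (vec_cols (Z \<omega>) \<otimes>\<^sub>v vec_cols (Z \<omega>)))"
  shows "A = (1 / 2 * (m2 - m4)) *\<^sub>R (J1 ** K2 + J2 ** K1 + J1 + J2 + K1 + K2)
           + m4 *\<^sub>R (mat 1 + J1 ** J2 + K1 ** K2)"
proof -
  note Z = assms(4) and sph = assms(5) and int = assms(6) and r = assms(7) and c = assms(8)
  define T where "T = moment4 M Z"
  define W where "W \<omega> = outer (vec_cols (Z \<omega>) \<otimes>\<^sub>v vec_cols (Z \<omega>)) (vec_cols (Z \<omega>) \<otimes>\<^sub>v vec_cols (Z \<omega>))"
    for \<omega>
  have W_nth: "W \<omega> $ ((k1, i1), (k2, i2)) $ ((k3, i3), (k4, i4)) =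
      Z \<omega> $ i1 $ k1 * Z \<omega> $ i2 $ k2 * Z \<omega> $ i3 $ k3 * Z \<omega> $ i4 $ k4" for \<omega> k1 k2 k3 k4 i1 i2 i3 i4
    by (simp add: W_def outer_def kron_vec_def vec_cols_def)
  have "integrable M (\<lambda>\<omega>. W \<omega> $ p $ q)" for p q
    using integrable_entries4[OF Z int] by (cases p; cases q) (auto simp: W_nth split_paired_all)
  \<comment> \<open>Integrability passes from entries to rows here and from rows to the matrix
    below, which allows the expectation to be taken entrywise.\<close>
  then have int_row: "integrable M (\<lambda>\<omega>. W \<omega> $ p)" for p
    by (intro integrable_vec)
  have A_nth: "A $ ((k1, i1), (k2, i2)) $ ((k3, i3), (k4, i4)) = T i1 i2 i3 i4 k1 k2 k3 k4"
    for k1 k2 k3 k4 i1 i2 i3 i4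
    using assms(11) integrable_vec[OF int_row] int_row
    by (simp add: W_def[symmetric] integral_vec_nth W_nth T_def moment4_def)
  have rows: "T i1 i2 i3 i4 k1 k2 k3 k4 = of_bool (i1 = i2 \<and> i3 = i4) * T r1 r1 r2 r2 k1 k2 k3 k4
      + of_bool (i1 = i3 \<and> i2 = i4) * T r1 r2 r1 r2 k1 k2 k3 k4
      + of_bool (i1 = i4 \<and> i2 = i3) * T r1 r2 r2 r1 k1 k2 k3 k4" for i1 i2 i3 i4 k1 k2 k3 k4
    unfolding T_def by (rule orthogonal_invariant4_expansion[OF moment4_row_invariant[OF Z sph int] r])
  have cols: "T i1 i2 i3 i4 k1 k2 k3 k4 = of_bool (k1 = k2 \<and> k3 = k4) * T i1 i2 i3 i4 c1 c1 c2 c2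
      + of_bool (k1 = k3 \<and> k2 = k4) * T i1 i2 i3 i4 c1 c2 c1 c2
      + of_bool (k1 = k4 \<and> k2 = k3) * T i1 i2 i3 i4 c1 c2 c2 c1" for i1 i2 i3 i4 k1 k2 k3 k4
    unfolding T_def by (rule orthogonal_invariant4_expansion[OF moment4_column_invariant[OF Z sph int] c])
  \<comment> \<open>The expectation of the product of the four distinct entries in rows
    \<open>r1\<close>, \<open>r2\<close> and columns \<open>c1\<close>, \<open>c2\<close>.\<close>
  define m3 where "m3 = T r1 r1 r2 r2 c1 c2 c1 c2"
  \<comment> \<open>If rows and columns are paired alike, the four factors are two squares of
    entries sharing neither row nor column.\<close>
  have T_same: "T r1 r1 r2 r2 c1 c1 c2 c2 = m4" "T r1 r2 r1 r2 c1 c2 c1 c2 = m4"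
    "T r1 r2 r2 r1 c1 c2 c2 c1 = m4"
    unfolding T_def moment4_def assms(10) by (simp_all add: power2_eq_square mult_ac)
  \<comment> \<open>If the pairings differ, each of the four entries occurs exactly once.\<close>
  have T_mixed: "T r1 r1 r2 r2 c1 c2 c1 c2 = m3" "T r1 r1 r2 r2 c1 c2 c2 c1 = m3"
    "T r1 r2 r1 r2 c1 c1 c2 c2 = m3" "T r1 r2 r1 r2 c1 c2 c2 c1 = m3"
    "T r1 r2 r2 r1 c1 c1 c2 c2 = m3" "T r1 r2 r2 r1 c1 c2 c1 c2 = m3"
    unfolding T_def moment4_def m3_def by (simp_all add: mult_ac)
  have "m2 = T r1 r1 r1 r1 c1 c1 c2 c2"
    unfolding T_def moment4_def assms(9) by (simp add: power2_eq_square mult_ac)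
  \<comment> \<open>With all row indices equal, all three row pairings contribute: one agrees with
    the column pairing and gives \<open>m4\<close>, the other two give \<open>m3\<close>.\<close>
  also have "\<dots> = m4 + 2 * m3"
    by (subst rows) (simp add: T_same T_mixed)
  finally have m3: "m3 = 1 / 2 * (m2 - m4)" by simp
  have "A $ p $ q = ((1 / 2 * (m2 - m4)) *\<^sub>R (J1 ** K2 + J2 ** K1 + J1 + J2 + K1 + K2)
      + m4 *\<^sub>R (mat 1 + J1 ** J2 + K1 ** K2)) $ p $ q" for p q
  proof -
    obtain k1 i1 k2 i2 where p: "p = ((k1, i1), (k2, i2))" by (metis surj_pair)
    obtain k3 i3 k4 i4 where q: "q = ((k3, i3), (k4, i4))" by (metis surj_pair)
    \<comment> \<open>Expanding in rows and then in columns gives nine indicators. Equal pairings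
      13|24, 12|34 and 14|23 match \<open>mat 1\<close>, \<open>J1 ** J2\<close> and
      \<open>K1 ** K2\<close>; the six mixed ones match the other matrices.\<close>
    show ?thesis
      unfolding p q A_nth m3[symmetric] vector_add_component vector_scaleR_component
        J1_nth J2_nth K1_nth K2_nth J1_mult_K2_nth J2_mult_K1_nth J1_mult_J2_nth K1_mult_K2_nth
        mat_1_pair_nth
        rows[of i1 i2 i3 i4] cols[of _ _ _ _ k1 k2 k3 k4] T_same T_mixed
      by (simp add: of_bool_conj algebra_simps)
  qed
  then show ?thesis by (simp add: vec_eq_iff)
qed

end
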